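(* Suppose $\alpha_A\le\alpha_B$, $X_A^{o}<\bar X_A<1$, and $\lambda_A\gg\gamma_B>0$ (that is, $\lambda_A$ is sufficiently large). Assume each country $i$ can decide a level of non-tariff trade barriers $\beta_i\ge0$ that increases the marginal costs of imports from country $j$ by $\beta_i$ but, unlike a tariff, grants no tariff income for country $i$. Tariffs and subsidies are enforceable as specified in the agreement but non-tariff barriers can be freely set. Then with the TIC Agreement it is strictly optimal for both countries to have zero non-tariff trade barriers (for each country $i$, given $\beta_j=0$ for the other country, $\beta_i=0$ is the unique optimal choice). In contrast, under the No-TIC Agreement country $B$ has incentives to erect non-tariff trade barriers $\beta_B>0$ if $$\gamma_B>\frac{\delta}{1+\eta_A}\qquad\text{with}\quad \eta_A=\frac{2-\bar X_A}{\bar X_A}.$$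
   Context: There are two countries $A,B$; $i,j\in\{A,B\}$ with $j\ne i$, and every formula for $i$ also holds with $i$ and $j$ swapped. There is a unit mass of products $m\in[0,1]$, each traded on its own independent perfectly competitive market. In each country demand for each product is exactly one unit at every price below a valuation $v$, which is large enough to exceed all equilibrium prices. The technological marginal cost of product $m$ in country $i$ is $w_i(m)$, and $\Delta w_A(m)=w_A(m)-w_B(m)=-\alpha_A+\delta m$, where $\alpha_A,\alpha_B>0$ and $\delta=\alpha_A+\alpha_B$. Instruments of country $i$: production subsidy $s_i\ge 0$, export subsidy $e_i\ge 0$, tariff $\tau_i\ge 0$, non-tariff barrier $\beta_i\ge0$. Possibly country $i$ has a tradeable import certificate (TIC) scheme with certificate price $\pi_i\ge0$ ($\pi_i=0$ if there is no TIC scheme): each imported unit requires one certificate, each exported unit generates $\eta_i$ certificates (the export credit factor), and exporters keep a share $\phi_i\in[0,1]$ of certificate revenues. Effective tariff: $\tilde\tau_i=\tau_i+\pi_i$. Effective export subsidy: $\tilde e_i=e_i+\phi_i\eta_i\pi_i$. Marginal costs: $c_i^{dom}(m)=w_i(m)-s_i$ for domestic sales and $c_i^{exp}(m)=w_i(m)-s_i-\tilde e_i+\tilde\tau_j+\beta_j$ for exports from $i$ to $j$. Market outcome: $q_i^{dom}(m)=1$ if $c_i^{dom}(m)\le c_j^{exp}(m)$ and $0$ otherwise; $q_i^{exp}(m)=1$ if $c_i^{exp}(m)<c_j^{dom}(m)$ and $0$ otherwise. Aggregates: $Q_i^{dom}=\int_0^1q_i^{dom}(m)\,dm$, $Q_i^{exp}=\int_0^1q_i^{exp}(m)\,dm$,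 $Q_i^{imp}=Q_j^{exp}$, total production $X_i=Q_i^{dom}+Q_i^{exp}$. $X_A^{o}=2\alpha_A/\delta$ is the free trade level of $X_A$. TIC market: if country $i$ has a TIC scheme, equilibrium requires $\eta_iQ_i^{exp}\ge Q_i^{imp}$, and the TIC market is in one of three types of equilibrium: binding ($\pi_i\ge0$ and $\eta_iQ_i^{exp}=Q_i^{imp}>0$), non-binding ($\pi_i=0$, $\eta_iQ_i^{exp}\ge Q_i^{imp}$, $Q_i^{exp}>0$), or pure autarky ($Q_i^{exp}=Q_i^{imp}=0$). Direct costs: $d_i^{dom}(m)=w_i(m)$, $d_i^{imp}(m)=c_j^{exp}(m)-\tau_i-\pi_i=w_j(m)-s_j-\tilde e_j+\beta_i$ (the barrier raises import costs without any rebate), $d_i^{exp}(m)=\tilde e_i+s_i$, and $$D_i=\int_0^1\left(d_i^{dom}(m)q_i^{dom}(m)+d_i^{imp}(m)q_j^{exp}(m)+d_i^{exp}(m)q_i^{exp}(m)\right)dm.$$ Country $A$ has a production goal $\bar X_A$ and utility $u_A=-\lambda_A\max(\bar X_A-X_A,0)-D_A$; country $B$ has utility $u_B=\gamma_BX_B-D_B$. "$\lambda_A\gg\gamma_B$" is read as: for given values of the other parameters, $\lambda_A$ is sufficiently large. A country "has incentives" to erect barriers if some $\beta_i>0$ gives it strictly higher utility than $\beta_i=0$. TIC Agreement: country $A$ implements a TIC scheme with $\eta_A=\frac{2-\bar X_A}{\bar X_A}>1$ and $\phi_A\eta_A=1$; country $B$ may also implement a TIC scheme with $\eta_B\ge1$;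 no country uses direct tariffs or subsidies ($\tau_i=e_i=s_i=0$). No-TIC Agreement: no TIC schemes; country $A$ fixes $e_A=\tau_A=\alpha_A\bar\chi_A$ with $\bar\chi_A=\frac{\bar X_A-X_A^{o}}{X_A^{o}}$ and $s_A=0$; country $B$ fixes $e_B=\tau_B=s_B=0$.
   Formalization: If country B has a TIC scheme with φ_B η_B < 1, pure autarky equilibria at zero barriers are excluded: prohibitive certificate prices can sustain them at every barrier level with equal utility, so zero barriers would not be strictly optimal along them. *)

theory Defs
  imports "HOL-Analysis.Analysis"
begin

datatype country = A | B

fun other :: "country \<Rightarrow> country" where
  "other A = B"
| "other B = A"

(* credit is the export credit factor \<eta>, share the exporters' share \<phi>. *)
record tic_scheme =
  credit :: real
  share :: real

record instruments =
  prod_subsidy :: real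
  exp_subsidy :: real
  tariff :: real
  barrier :: real
  tic :: "tic_scheme option"

(* Conventions for the arguments below: w i m is the technological marginal cost of product
   m \<in> [0,1] in country i, P the policies of the two countries, and p the certificate prices. *)

definition eff_tariff ::
  "(country \<Rightarrow> instruments) \<Rightarrow> (country \<Rightarrow> real) \<Rightarrow> country \<Rightarrow> real" where
  "eff_tariff P p i = tariff (P i) + p i"

definition eff_exp_subsidy ::
  "(country \<Rightarrow> instruments) \<Rightarrow> (country \<Rightarrow> real) \<Rightarrow> country \<Rightarrow> real" where
  "eff_exp_subsidy P p i = exp_subsidy (P i) +
     (case tic (P i) of None \<Rightarrow> 0 | Some T \<Rightarrow> share T * credit T * p i)"

context
  fixes w :: "country \<Rightarrow> real \<Rightarrow> real"
    and P :: "country \<Rightarrow> instruments"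
    and p :: "country \<Rightarrow> real"
begin

definition c_dom :: "country \<Rightarrow> real \<Rightarrow> real" where
  "c_dom i m = w i m - prod_subsidy (P i)"

definition c_exp :: "country \<Rightarrow> real \<Rightarrow> real" where
  "c_exp i m = w i m - prod_subsidy (P i) - eff_exp_subsidy P p i
     + eff_tariff P p (other i) + barrier (P (other i))"

definition q_dom :: "country \<Rightarrow> real \<Rightarrow> real" where
  "q_dom i m = (if c_dom i m \<le> c_exp (other i) m then 1 else 0)"

definition q_exp :: "country \<Rightarrow> real \<Rightarrow> real" where
  "q_exp i m = (if c_exp i m < c_dom (other i) m then 1 else 0)"

definition Q_dom :: "country \<Rightarrow> real" where
  "Q_dom i = integral {0..1} (q_dom i)"

definition Q_exp :: "country \<Rightarrow> real" where
  "Q_exp i = integral {0..1} (q_exp i)"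

definition Q_imp :: "country \<Rightarrow> real" where
  "Q_imp i = Q_exp (other i)"

definition production :: "country \<Rightarrow> real" where
  "production i = Q_dom i + Q_exp i"

definition d_dom :: "country \<Rightarrow> real \<Rightarrow> real" where
  "d_dom i m = w i m"

definition d_imp :: "country \<Rightarrow> real \<Rightarrow> real" where
  "d_imp i m = c_exp (other i) m - tariff (P i) - p i"

definition d_exp :: "country \<Rightarrow> real \<Rightarrow> real" where
  "d_exp i m = eff_exp_subsidy P p i + prod_subsidy (P i)"

definition direct_cost :: "country \<Rightarrow> real" where
  "direct_cost i = integral {0..1} (\<lambda>m. d_dom i m * q_dom i m
     + d_imp i m * q_exp (other i) m + d_exp i m * q_exp i m)"

definition binding :: "country \<Rightarrow> real \<Rightarrow> bool" where
  "binding i \<eta> \<longleftrightarrow> 0 \<le> p i \<and> \<eta> * Q_exp i = Q_imp i \<and> 0 < Q_imp i"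

definition non_binding :: "country \<Rightarrow> real \<Rightarrow> bool" where
  "non_binding i \<eta> \<longleftrightarrow> p i = 0 \<and> \<eta> * Q_exp i \<ge> Q_imp i \<and> 0 < Q_exp i"

definition pure_autarky :: "country \<Rightarrow> bool" where
  "pure_autarky i \<longleftrightarrow> Q_exp i = 0 \<and> Q_imp i = 0"

definition equilibrium :: bool where
  "equilibrium \<longleftrightarrow> (\<forall>i. case tic (P i) of
       None \<Rightarrow> p i = 0
     | Some T \<Rightarrow> 0 \<le> p i \<and> credit T * Q_exp i \<ge> Q_imp i \<and>
         (binding i (credit T) \<or> non_binding i (credit T) \<or> pure_autarky i))"

(* If exporters in some country receive less than one certificate price per exported unit
   (\<phi> \<eta> < 1), prohibitive certificate prices in both countries can sustain pure autarky
   whatever the barriers are, although an equilibrium with trade exists. Only this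
   coordination failure is excluded; otherwise the notion is that of an equilibrium. *)
definition coordinated_equilibrium :: bool where
  "coordinated_equilibrium \<longleftrightarrow> equilibrium \<and>
     ((\<exists>i T. tic (P i) = Some T \<and> share T * credit T < 1) \<longrightarrow> (\<forall>i. \<not> pure_autarky i))"

end

(* lam: weight of A's production goal Xbar; gam: weight of production in B's utility. *)
definition utility ::
  "real \<Rightarrow> real \<Rightarrow> real \<Rightarrow> (country \<Rightarrow> real \<Rightarrow> real) \<Rightarrow> (country \<Rightarrow> instruments) \<Rightarrow>
   (country \<Rightarrow> real) \<Rightarrow> country \<Rightarrow> real" where
  "utility lam Xbar gam w P p i = (case i of
       A \<Rightarrow> - lam * max (Xbar - production w P p A) 0 - direct_cost w P p A
     | B \<Rightarrow> gam * production w P p B - direct_cost w P p B)"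

definition with_barrier ::
  "(country \<Rightarrow> instruments) \<Rightarrow> country \<Rightarrow> real \<Rightarrow> (country \<Rightarrow> instruments)" where
  "with_barrier P i b = P(i := (P i)\<lparr>barrier := b\<rparr>)"

(* Utility is a function of the policies and the certificate prices, and the latter need not be
   unique. So equilibria have to exist at every barrier level, and every equilibrium at a
   positive barrier has to be strictly worse than every coordinated one at a zero barrier. *)
definition zero_barrier_strictly_optimal ::
  "real \<Rightarrow> real \<Rightarrow> real \<Rightarrow> (country \<Rightarrow> real \<Rightarrow> real) \<Rightarrow> (country \<Rightarrow> instruments) \<Rightarrow>
   country \<Rightarrow> bool" where
  "zero_barrier_strictly_optimal lam Xbar gam w P i \<longleftrightarrow>
     (\<exists>p. coordinated_equilibrium w (with_barrier P i 0) p) \<and>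
     (\<forall>b>0. \<exists>p. equilibrium w (with_barrier P i b) p) \<and>
     (\<forall>b>0. \<forall>p p'. coordinated_equilibrium w (with_barrier P i 0) p \<longrightarrow>
        equilibrium w (with_barrier P i b) p' \<longrightarrow>
        utility lam Xbar gam w (with_barrier P i b) p' i
          < utility lam Xbar gam w (with_barrier P i 0) p i)"

(* For policies without TIC schemes: all certificate prices are 0. *)
definition barrier_incentive_no_tic ::
  "real \<Rightarrow> real \<Rightarrow> real \<Rightarrow> (country \<Rightarrow> real \<Rightarrow> real) \<Rightarrow> (country \<Rightarrow> instruments) \<Rightarrow>
   country \<Rightarrow> bool" where
  "barrier_incentive_no_tic lam Xbar gam w P i \<longleftrightarrow>
     (\<exists>b>0. utility lam Xbar gam w (with_barrier P i 0) (\<lambda>_. 0) i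
        < utility lam Xbar gam w (with_barrier P i b) (\<lambda>_. 0) i)"

definition free_trade_production_A :: "(country \<Rightarrow> real) \<Rightarrow> real" where
  "free_trade_production_A \<alpha> = 2 * \<alpha> A / (\<alpha> A + \<alpha> B)"

definition eta_A :: "real \<Rightarrow> real" where
  "eta_A Xbar = (2 - Xbar) / Xbar"

definition tic_agreement ::
  "tic_scheme \<Rightarrow> tic_scheme option \<Rightarrow> country \<Rightarrow> instruments" where
  "tic_agreement T\<^sub>A T\<^sub>B i =
     \<lparr>prod_subsidy = 0, exp_subsidy = 0, tariff = 0, barrier = 0,
      tic = (case i of A \<Rightarrow> Some T\<^sub>A | B \<Rightarrow> T\<^sub>B)\<rparr>"

definition chi_A :: "(country \<Rightarrow> real) \<Rightarrow> real \<Rightarrow> real" where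
  "chi_A \<alpha> Xbar = (Xbar - free_trade_production_A \<alpha>) / free_trade_production_A \<alpha>"

definition no_tic_agreement ::
  "(country \<Rightarrow> real) \<Rightarrow> real \<Rightarrow> country \<Rightarrow> instruments" where
  "no_tic_agreement \<alpha> Xbar i =
     (let t = (case i of A \<Rightarrow> \<alpha> A * chi_A \<alpha> Xbar | B \<Rightarrow> 0)
      in \<lparr>prod_subsidy = 0, exp_subsidy = t, tariff = t, barrier = 0, tic = None\<rparr>)"

end

(* Write x and y for the exports of A and B, and t = Xbar / 2, so that eta_A = (1 - t) / t.
   Since the cost gap is affine in m, exports are determined by cutoffs and each direct cost is
   the autarky cost minus a quadratic polynomial in x and y. If A's certificate market binds,
   y = eta_A x > x, so B's certificates are in excess supply and worthless, and
   delta (x + y) = delta - beta_A - beta_B. At zero barriers this leaves only x = t; a barrier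
   lowers x and y proportionally, which destroys gains from trade for A and, because
   eta_A > 1, also production X_B = 1 + (eta_A - 1) x for B. The other equilibria trade less
   and yield smaller gains as well. Without certificates B's barrier lowers x alone, which
   raises B's production one for one and pays off as soon as gamma exceeds delta t. *)

theory Submission
  imports Defs
begin

section \<open>Integrals of truncated affine functions over the unit interval\<close>

definition clip :: "real \<Rightarrow> real" where
  "clip u = max 0 (min 1 u)"

lemma clip_id: "0 \<le> u \<Longrightarrow> u \<le> 1 \<Longrightarrow> clip u = u"
  by (simp add: clip_def)

lemma clip_bounds: "0 \<le> clip u" "clip u \<le> 1"
  by (auto simp: clip_def)

lemma clip_pos_iff: "0 < clip u \<longleftrightarrow> 0 < u"
  by (auto simp: clip_def)

lemma clip_less_1_iff: "clip u < 1 \<longleftrightarrow> u < 1"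
  by (auto simp: clip_def)

lemma clip_nonpos: "u \<le> 0 \<Longrightarrow> clip u = 0"
  by (simp add: clip_def)

lemma clip_ge_1: "1 \<le> u \<Longrightarrow> clip u = 1"
  by (simp add: clip_def)

lemma has_integral_affine:
  fixes r s l u :: real
  assumes "l \<le> u"
  shows "((\<lambda>m. r * m + s) has_integral (r * u\<^sup>2 / 2 + s * u - (r * l\<^sup>2 / 2 + s * l))) {l..u}"
  by (rule fundamental_theorem_of_calculus[OF assms])
    (auto simp flip: has_real_derivative_iff_has_vector_derivative intro!: derivative_eq_intros)

text \<open>The cutoff \<open>h\<close> may lie outside the unit interval, where one country exports
  everything or nothing. Up to finitely many points the region of integration runs from 0 to
  \<open>clip h\<close>.\<close>

lemma has_integral_affine_below:
  "((\<lambda>m. if m < h then r * m + s else 0) has_integral (r * (clip h)\<^sup>2 / 2 + s * clip h)) {0..1}"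
proof -
  have "((\<lambda>m. r * m + s) has_integral (r * (clip h)\<^sup>2 / 2 + s * clip h)) {0..clip h}"
    using has_integral_affine[of 0 "clip h" r s] clip_bounds by simp
  then have "((\<lambda>m. if m \<in> {0..clip h} then r * m + s else 0)
      has_integral (r * (clip h)\<^sup>2 / 2 + s * clip h)) {0..1}"
    using clip_bounds by (subst has_integral_restrict) auto
  then show ?thesis
    \<comment> \<open>The integrands can disagree only at \<open>clip h\<close>, which lies in the
      exceptional set.\<close>
    by (rule has_integral_spike_finite[of "{0, 1, h}", rotated 2])
      (auto simp: clip_def split: if_splits)
qed

lemma has_integral_affine_above:
  "((\<lambda>m. if h < m then r * m + s else 0)
     has_integral (r * (1 - (clip h)\<^sup>2) / 2 + s * (1 - clip h))) {0..1}"
proof -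
  have "((\<lambda>m. (r * m + s) - (if m < h then r * m + s else 0))
     has_integral (r / 2 + s - (r * (clip h)\<^sup>2 / 2 + s * clip h))) {0..1}"
    using has_integral_diff[OF has_integral_affine[of 0 1 r s] has_integral_affine_below] by simp
  then have "((\<lambda>m. (r * m + s) - (if m < h then r * m + s else 0))
     has_integral (r * (1 - (clip h)\<^sup>2) / 2 + s * (1 - clip h))) {0..1}"
    by (simp add: algebra_simps diff_divide_distrib)
  then show ?thesis
    by (rule has_integral_spike_finite[of "{h}", rotated 2]) (auto split: if_splits)
qed

section \<open>Exports, production and direct costs for an affine cost gap\<close>

locale linear_cost_gap =
  fixes w :: "country \<Rightarrow> real \<Rightarrow> real" and a \<delta> :: real
  assumes \<delta>_pos: "0 < \<delta>"
    and gap: "\<And>m. m \<in> {0..1} \<Longrightarrow> w A m - w B m = - a + \<delta> * m"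
    and w_integrable: "\<And>i. w i integrable_on {0..1}"
begin

text \<open>The formal solution in \<open>m\<close> of \<open>c_exp A m = c_dom B m\<close>; it may
  fall outside the unit interval. Since the cost gap increases in \<open>m\<close>, A exports the
  products below \<open>cutoff_A\<close> and B those above \<open>cutoff_B\<close>.\<close>

definition cutoff_A :: "(country \<Rightarrow> instruments) \<Rightarrow> (country \<Rightarrow> real) \<Rightarrow> real" where
  "cutoff_A P p = (a + prod_subsidy (P A) - prod_subsidy (P B) + eff_exp_subsidy P p A
     - eff_tariff P p B - barrier (P B)) / \<delta>"

definition cutoff_B :: "(country \<Rightarrow> instruments) \<Rightarrow> (country \<Rightarrow> real) \<Rightarrow> real" where
  "cutoff_B P p = (a + prod_subsidy (P A) - prod_subsidy (P B) - eff_exp_subsidy P p B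
     + eff_tariff P p A + barrier (P A)) / \<delta>"

lemma q_exp_A: "m \<in> {0..1} \<Longrightarrow> q_exp w P p A m = (if m < cutoff_A P p then 1 else 0)"
  using gap[of m] \<delta>_pos
  by (auto simp: q_exp_def c_exp_def c_dom_def cutoff_A_def field_simps)

lemma q_exp_B: "m \<in> {0..1} \<Longrightarrow> q_exp w P p B m = (if cutoff_B P p < m then 1 else 0)"
  using gap[of m] \<delta>_pos
  by (auto simp: q_exp_def c_exp_def c_dom_def cutoff_B_def field_simps)

text \<open>Ties go to the domestic producer, so each product has exactly one supplier in each
  country.\<close>

lemma q_dom_eq: "q_dom w P p i m = 1 - q_exp w P p (other i) m"
  by (cases i) (auto simp: q_dom_def q_exp_def)

lemma q_exp_has_integral:
  "(q_exp w P p A has_integral clip (cutoff_A P p)) {0..1}"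
  "(q_exp w P p B has_integral 1 - clip (cutoff_B P p)) {0..1}"
proof -
  have "((\<lambda>m. if m < cutoff_A P p then 1 else 0) has_integral clip (cutoff_A P p)) {0..1}"
    using has_integral_affine_below[of "cutoff_A P p" 0 1] by (simp cong: if_cong)
  then show "(q_exp w P p A has_integral clip (cutoff_A P p)) {0..1}"
    by (rule has_integral_eq[rotated]) (simp add: q_exp_A)
  have "((\<lambda>m. if cutoff_B P p < m then 1 else 0) has_integral 1 - clip (cutoff_B P p)) {0..1}"
    using has_integral_affine_above[of "cutoff_B P p" 0 1] by (simp cong: if_cong)
  then show "(q_exp w P p B has_integral 1 - clip (cutoff_B P p)) {0..1}"
    by (rule has_integral_eq[rotated]) (simp add: q_exp_B)
qed

lemma Q_exp_A: "Q_exp w P p A = clip (cutoff_A P p)"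
  and Q_exp_B: "Q_exp w P p B = 1 - clip (cutoff_B P p)"
  unfolding Q_exp_def by (auto intro!: integral_unique q_exp_has_integral)

lemma q_exp_has_integral_Q_exp: "(q_exp w P p i has_integral Q_exp w P p i) {0..1}"
  by (cases i) (auto simp: Q_exp_A Q_exp_B q_exp_has_integral)

lemma production_eq: "production w P p i = 1 - Q_exp w P p (other i) + Q_exp w P p i"
proof -
  have "((\<lambda>m. 1 - q_exp w P p (other i) m) has_integral 1 - Q_exp w P p (other i)) {0..1}"
    using has_integral_diff[OF has_integral_const_real[of 1 0 1] q_exp_has_integral_Q_exp] by simp
  then have "Q_dom w P p i = 1 - Q_exp w P p (other i)"
    unfolding Q_dom_def by (intro integral_unique) (simp add: q_dom_eq[abs_def])
  then show ?thesis
    by (simp add: production_def)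
qed

text \<open>Importing product \<open>m\<close> instead of making it saves A the amount
  \<open>\<delta> * m - c\<close>, because its own tariff and certificate price come back as income
  while its barrier does not. The imported products fill the interval from \<open>1 - y\<close> to
  1, over which the saving integrates to the quadratic expression.\<close>

lemma direct_cost_A:
  fixes P p
  defines "x \<equiv> Q_exp w P p A" and "y \<equiv> Q_exp w P p B"
  defines "c \<equiv> a - prod_subsidy (P B) - eff_exp_subsidy P p B + barrier (P A)"
  shows "direct_cost w P p A = integral {0..1} (w A) - (\<delta> * (y - y\<^sup>2 / 2) - c * y)
    + (eff_exp_subsidy P p A + prod_subsidy (P A)) * x"
proof -
  have z: "clip (cutoff_B P p) = 1 - y"
    by (simp add: y_def Q_exp_B)
  have *: "d_dom w A m * q_dom w P p A m + d_imp w P p A m * q_exp w P p B m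
        + d_exp P p A m * q_exp w P p A m
      = w A m - (if cutoff_B P p < m then \<delta> * m + (- c) else 0)
        + (eff_exp_subsidy P p A + prod_subsidy (P A)) * q_exp w P p A m" if "m \<in> {0..1}" for m
    using gap[OF that] unfolding q_dom_eq
    by (auto simp: q_exp_B[OF that] d_dom_def d_imp_def d_exp_def c_exp_def c_def eff_tariff_def)
  have "((\<lambda>m. w A m - (if cutoff_B P p < m then \<delta> * m + (- c) else 0)
        + (eff_exp_subsidy P p A + prod_subsidy (P A)) * q_exp w P p A m)
      has_integral (integral {0..1} (w A)
        - (\<delta> * (1 - (clip (cutoff_B P p))\<^sup>2) / 2 + (- c) * (1 - clip (cutoff_B P p)))
        + (eff_exp_subsidy P p A + prod_subsidy (P A)) * x)) {0..1}"
    unfolding x_def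
    by (intro has_integral_add has_integral_diff has_integral_affine_above
        has_integral_mult_right q_exp_has_integral_Q_exp integrable_integral w_integrable)
  then have "direct_cost w P p A = integral {0..1} (w A)
        - (\<delta> * (1 - (clip (cutoff_B P p))\<^sup>2) / 2 + (- c) * (1 - clip (cutoff_B P p)))
        + (eff_exp_subsidy P p A + prod_subsidy (P A)) * x"
    unfolding direct_cost_def other.simps
    by (intro integral_unique) (subst has_integral_cong[OF *], assumption+)
  then show ?thesis
    unfolding z by (simp add: field_simps power2_eq_square)
qed

text \<open>Mirror image of the computation for A: B imports the products from 0 to \<open>x\<close>
  and saves \<open>c - \<delta> * m\<close> on each.\<close>

lemma direct_cost_B:
  fixes P p
  defines "x \<equiv> Q_exp w P p A" and "y \<equiv> Q_exp w P p B"
  defines "c \<equiv> a + prod_subsidy (P A) + eff_exp_subsidy P p A - barrier (P B)"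
  shows "direct_cost w P p B = integral {0..1} (w B) - (c * x - \<delta> * x\<^sup>2 / 2)
    + (eff_exp_subsidy P p B + prod_subsidy (P B)) * y"
proof -
  have z: "clip (cutoff_A P p) = x"
    by (simp add: x_def Q_exp_A)
  have *: "d_dom w B m * q_dom w P p B m + d_imp w P p B m * q_exp w P p A m
        + d_exp P p B m * q_exp w P p B m
      = w B m + (if m < cutoff_A P p then \<delta> * m + (- c) else 0)
        + (eff_exp_subsidy P p B + prod_subsidy (P B)) * q_exp w P p B m" if "m \<in> {0..1}" for m
    using gap[OF that] unfolding q_dom_eq
    by (auto simp: q_exp_A[OF that] d_dom_def d_imp_def d_exp_def c_exp_def c_def eff_tariff_def)
  have "((\<lambda>m. w B m + (if m < cutoff_A P p then \<delta> * m + (- c) else 0)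
        + (eff_exp_subsidy P p B + prod_subsidy (P B)) * q_exp w P p B m)
      has_integral (integral {0..1} (w B)
        + (\<delta> * (clip (cutoff_A P p))\<^sup>2 / 2 + (- c) * clip (cutoff_A P p))
        + (eff_exp_subsidy P p B + prod_subsidy (P B)) * y)) {0..1}"
    unfolding y_def
    by (intro has_integral_add has_integral_diff has_integral_affine_below
        has_integral_mult_right q_exp_has_integral_Q_exp integrable_integral w_integrable)
  then have "direct_cost w P p B = integral {0..1} (w B)
        + (\<delta> * (clip (cutoff_A P p))\<^sup>2 / 2 + (- c) * clip (cutoff_A P p))
        + (eff_exp_subsidy P p B + prod_subsidy (P B)) * y"
    unfolding direct_cost_def other.simps
    by (intro integral_unique) (subst has_integral_cong[OF *], assumption+)
  then show ?thesis
    unfolding z by (simp add: field_simps power2_eq_square)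
qed

end

section \<open>The TIC Agreement at arbitrary barriers\<close>

text \<open>Here \<open>a\<close> is \<alpha> of A and \<open>t\<close> is half the production goal.
  Then \<open>a_le\<close> expresses that A has the smaller \<alpha>, and \<open>a_less\<close> that
  the goal exceeds free trade production.\<close>

locale tic_economy = linear_cost_gap +
  fixes T\<^sub>A :: tic_scheme and T\<^sub>B :: "tic_scheme option" and t :: real
  assumes a_pos: "0 < a"
    and a_le: "a \<le> \<delta> / 2"
    and a_less: "a < \<delta> * t"
    and t_less: "t < 1 / 2"
    and credit_A: "credit T\<^sub>A = (1 - t) / t"
    and share_A: "share T\<^sub>A * credit T\<^sub>A = 1"
    and T\<^sub>B: "\<And>T. T\<^sub>B = Some T \<Longrightarrow> 1 \<le> credit T \<and> 0 \<le> share T"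
begin

definition policy :: "real \<Rightarrow> real \<Rightarrow> country \<Rightarrow> instruments" where
  "policy \<beta>\<^sub>A \<beta>\<^sub>B i = (tic_agreement T\<^sub>A T\<^sub>B i)\<lparr>barrier := (case i of A \<Rightarrow> \<beta>\<^sub>A | B \<Rightarrow> \<beta>\<^sub>B)\<rparr>"

text \<open>The subsidy per exported unit that B's exporters draw from each unit of B's certificate
  price. The corresponding factor for A is 1 by \<open>share_A\<close>.\<close>

definition \<kappa> :: real where
  "\<kappa> = (case T\<^sub>B of None \<Rightarrow> 0 | Some T \<Rightarrow> share T * credit T)"

abbreviation \<eta> :: real where
  "\<eta> \<equiv> (1 - t) / t"

lemma with_barrier_tic_agreement:
  "with_barrier (tic_agreement T\<^sub>A T\<^sub>B) A \<beta> = policy \<beta> 0"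
  "with_barrier (tic_agreement T\<^sub>A T\<^sub>B) B \<beta> = policy 0 \<beta>"
  by (rule ext, simp add: with_barrier_def policy_def tic_agreement_def split: country.split)+

lemma t_pos: "0 < t"
  using a_pos a_less \<delta>_pos by (metis less_trans zero_less_mult_pos)

lemma \<eta>_t: "\<eta> * t = 1 - t" and \<eta>_gt_1: "1 < \<eta>"
  using t_pos t_less by (auto simp: field_simps)

lemma \<kappa>_nonneg: "0 \<le> \<kappa>"
  using T\<^sub>B by (auto simp: \<kappa>_def split: option.split)

lemma policy_simps [simp]:
  "prod_subsidy (policy \<beta>\<^sub>A \<beta>\<^sub>B i) = 0"
  "tariff (policy \<beta>\<^sub>A \<beta>\<^sub>B i) = 0"
  "barrier (policy \<beta>\<^sub>A \<beta>\<^sub>B A) = \<beta>\<^sub>A"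
  "barrier (policy \<beta>\<^sub>A \<beta>\<^sub>B B) = \<beta>\<^sub>B"
  "tic (policy \<beta>\<^sub>A \<beta>\<^sub>B A) = Some T\<^sub>A"
  "tic (policy \<beta>\<^sub>A \<beta>\<^sub>B B) = T\<^sub>B"
  "eff_tariff (policy \<beta>\<^sub>A \<beta>\<^sub>B) p i = p i"
  "eff_exp_subsidy (policy \<beta>\<^sub>A \<beta>\<^sub>B) p A = p A"
  "eff_exp_subsidy (policy \<beta>\<^sub>A \<beta>\<^sub>B) p B = \<kappa> * p B"
  using share_A
  by (auto simp: policy_def tic_agreement_def eff_tariff_def eff_exp_subsidy_def \<kappa>_def
      split: option.split)

lemma cutoff_A_policy: "cutoff_A (policy \<beta>\<^sub>A \<beta>\<^sub>B) p = (a + p A - p B - \<beta>\<^sub>B) / \<delta>"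
  and cutoff_B_policy: "cutoff_B (policy \<beta>\<^sub>A \<beta>\<^sub>B) p = (a + p A - \<kappa> * p B + \<beta>\<^sub>A) / \<delta>"
  by (simp_all add: cutoff_A_def cutoff_B_def)

lemma Q_exp_policy:
  "Q_exp w (policy \<beta>\<^sub>A \<beta>\<^sub>B) p A = clip ((a + p A - p B - \<beta>\<^sub>B) / \<delta>)"
  "Q_exp w (policy \<beta>\<^sub>A \<beta>\<^sub>B) p B = 1 - clip ((a + p A - \<kappa> * p B + \<beta>\<^sub>A) / \<delta>)"
  by (simp_all add: Q_exp_A Q_exp_B cutoff_A_policy cutoff_B_policy)

lemma all_country: "(\<forall>i. R i) \<longleftrightarrow> R A \<and> R B"
  by (metis country.exhaust)

section \<open>Classification of the equilibria\<close>

lemma equilibrium_policy_iff: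
  fixes \<beta>\<^sub>A \<beta>\<^sub>B p
  defines "x \<equiv> Q_exp w (policy \<beta>\<^sub>A \<beta>\<^sub>B) p A" and "y \<equiv> Q_exp w (policy \<beta>\<^sub>A \<beta>\<^sub>B) p B"
  shows "equilibrium w (policy \<beta>\<^sub>A \<beta>\<^sub>B) p \<longleftrightarrow>
    0 \<le> p A \<and> y \<le> \<eta> * x \<and> (\<eta> * x = y \<and> 0 < y \<or> p A = 0 \<and> 0 < x \<or> x = 0 \<and> y = 0) \<and>
    (case T\<^sub>B of None \<Rightarrow> p B = 0 | Some T \<Rightarrow> 0 \<le> p B \<and> x \<le> credit T * y \<and>
      (credit T * y = x \<and> 0 < x \<or> p B = 0 \<and> 0 < y \<or> x = 0 \<and> y = 0))"
  unfolding equilibrium_def all_country policy_simps option.case credit_A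
    binding_def non_binding_def pure_autarky_def Q_imp_def other.simps x_def[symmetric] y_def[symmetric]
  by (auto split: option.split)

text \<open>With trade, a positive certificate price in B forces \<open>x = e * y\<close> with
  \<open>e \<ge> 1\<close>, hence \<open>y \<le> x < \<eta> * x\<close>. A's credit constraint is
  then slack and \<open>p A = 0\<close>, so both prices cannot be positive at once unless there is
  autarky. The case \<open>non_binding\<close> includes \<open>y = 0\<close>.\<close>

lemma equilibrium_policyE:
  fixes \<beta>\<^sub>A \<beta>\<^sub>B p
  defines "x \<equiv> Q_exp w (policy \<beta>\<^sub>A \<beta>\<^sub>B) p A" and "y \<equiv> Q_exp w (policy \<beta>\<^sub>A \<beta>\<^sub>B) p B"
  assumes "equilibrium w (policy \<beta>\<^sub>A \<beta>\<^sub>B) p"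
  obtains (autarky) "x = 0" "y = 0" "0 \<le> p A" "0 \<le> p B" "T\<^sub>B = None \<Longrightarrow> p B = 0"
  | (binding) "y = \<eta> * x" "0 < x" "0 < y" "0 \<le> p A" "p B = 0"
  | (non_binding) "p A = 0" "0 < x" "y \<le> \<eta> * x" "p B = 0"
  | (binding_B) "p A = 0" "0 < x" "0 < y" "y \<le> x" "0 < p B"
proof -
  note eq = assms(3)[unfolded equilibrium_policy_iff, folded x_def y_def]
  have A: "0 \<le> p A" "y \<le> \<eta> * x" "\<eta> * x = y \<and> 0 < y \<or> p A = 0 \<and> 0 < x \<or> x = 0 \<and> y = 0"
    using eq by blast+
  have B: "p B = 0 \<or> (\<exists>e\<ge>1. 0 < p B \<and> (e * y = x \<and> 0 < x \<or> x = 0 \<and> y = 0))"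
    "T\<^sub>B = None \<Longrightarrow> p B = 0" "0 \<le> p B"
    using eq T\<^sub>B by (cases T\<^sub>B; force)+
  have "0 \<le> x" "0 \<le> y"
    using clip_bounds by (auto simp: x_def y_def Q_exp_policy)
  show ?thesis
  proof (cases "p B = 0")
    case True
    then show ?thesis
      using A \<eta>_gt_1 \<open>0 \<le> x\<close> autarky binding non_binding
      by (smt (verit) mult_eq_0_iff)
  next
    case False
    show ?thesis
    proof (cases "x = 0 \<and> y = 0")
      case False
      then obtain e where e: "e \<ge> 1" "e * y = x" "0 < x" "0 < p B"
        using B \<open>p B \<noteq> 0\<close> by auto
      have "0 < y"
        using e \<open>0 \<le> y\<close> by (cases "y = 0") auto
      have "y \<le> x"
        using e \<open>0 < y\<close> by (metis mult_right_mono mult_1 less_imp_le)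
      have "x < \<eta> * x"
        using \<eta>_gt_1 \<open>0 < x\<close> by (simp add: mult_less_cancel_right1 del: times_divide_eq_left)
      then have "p A = 0"
        using A \<open>y \<le> x\<close> \<open>0 < x\<close> by auto
      then show ?thesis
        using e \<open>0 < y\<close> \<open>y \<le> x\<close> binding_B by blast
    qed (use A B autarky in blast)
  qed
qed

text \<open>Reduces existence to finding a price of A at which its certificate market binds. Since
  \<eta> exceeds 1, B then exports more than it imports, so its certificates are in excess supply
  and the price 0 is admissible for them.\<close>

lemma equilibrium_policy_price_B_0:
  fixes \<beta>\<^sub>A \<beta>\<^sub>B p
  defines "x \<equiv> Q_exp w (policy \<beta>\<^sub>A \<beta>\<^sub>B) p A" and "y \<equiv> Q_exp w (policy \<beta>\<^sub>A \<beta>\<^sub>B) p B"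
  assumes "0 \<le> p A" "p B = 0" "y = \<eta> * x" "0 < x"
  shows "equilibrium w (policy \<beta>\<^sub>A \<beta>\<^sub>B) p"
proof -
  have "x < y"
    unfolding assms(5) using mult_strict_right_mono[OF \<eta>_gt_1 \<open>0 < x\<close>] by simp
  moreover have "x \<le> e * y" if "1 \<le> e" for e
  proof -
    have "y \<le> e * y"
      using that \<open>x < y\<close> \<open>0 < x\<close> by (simp add: mult_le_cancel_right1)
    then show ?thesis
      using \<open>x < y\<close> by simp
  qed
  ultimately show ?thesis
    using assms(3-) T\<^sub>B unfolding equilibrium_policy_iff x_def[symmetric] y_def[symmetric]
    by (auto split: option.split)
qed

section \<open>Utilities and trade volumes in equilibrium\<close>

lemma utility_A:
  fixes \<beta>\<^sub>A \<beta>\<^sub>B p lam X gam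
  defines "x \<equiv> Q_exp w (policy \<beta>\<^sub>A \<beta>\<^sub>B) p A" and "y \<equiv> Q_exp w (policy \<beta>\<^sub>A \<beta>\<^sub>B) p B"
  shows "utility lam X gam w (policy \<beta>\<^sub>A \<beta>\<^sub>B) p A = - lam * max (X - (1 - y + x)) 0
    - integral {0..1} (w A) + \<delta> * (y - y\<^sup>2 / 2) - (a - \<kappa> * p B + \<beta>\<^sub>A) * y - p A * x"
  by (simp add: utility_def production_eq direct_cost_A x_def y_def)

lemma utility_B:
  fixes \<beta>\<^sub>A \<beta>\<^sub>B p lam X gam
  defines "x \<equiv> Q_exp w (policy \<beta>\<^sub>A \<beta>\<^sub>B) p A" and "y \<equiv> Q_exp w (policy \<beta>\<^sub>A \<beta>\<^sub>B) p B"
  shows "utility lam X gam w (policy \<beta>\<^sub>A \<beta>\<^sub>B) p B = gam * (1 - x + y)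
    - integral {0..1} (w B) + (a + p A - \<beta>\<^sub>B) * x - \<delta> * x\<^sup>2 / 2 - \<kappa> * p B * y"
  by (simp add: utility_def production_eq direct_cost_B x_def y_def)

text \<open>Positive \<open>x\<close> and \<open>y\<close> keep both cutoffs strictly inside the
  unit interval, so no truncation occurs and the two volumes are affine in \<open>p A\<close> with
  opposite slopes. Adding them eliminates the price. The binding condition gives A the share
  \<open>1 / (1 + \<eta>) = t\<close> of total exports, which determines \<open>x\<close>.\<close>

lemma binding_outcome:
  fixes \<beta>\<^sub>A \<beta>\<^sub>B p
  defines "x \<equiv> Q_exp w (policy \<beta>\<^sub>A \<beta>\<^sub>B) p A" and "y \<equiv> Q_exp w (policy \<beta>\<^sub>A \<beta>\<^sub>B) p B"
  assumes "0 \<le> \<beta>\<^sub>A" "0 \<le> \<beta>\<^sub>B"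
    and "y = \<eta> * x" "0 < x" "0 < y" "0 \<le> p A" "p B = 0"
  shows "\<delta> * x = a + p A - \<beta>\<^sub>B" "\<delta> * y = \<delta> - a - p A - \<beta>\<^sub>A" "\<delta> * x = t * (\<delta> - \<beta>\<^sub>A - \<beta>\<^sub>B)"
proof -
  have "clip ((a + p A + \<beta>\<^sub>A) / \<delta>) < 1"
    using assms by (simp add: Q_exp_policy)
  then have lt: "a + p A + \<beta>\<^sub>A < \<delta>"
    using \<delta>_pos by (simp add: clip_less_1_iff)
  have "0 < clip ((a + p A - \<beta>\<^sub>B) / \<delta>)"
    using assms by (simp add: Q_exp_policy)
  then have gt: "0 < a + p A - \<beta>\<^sub>B"
    using \<delta>_pos by (simp add: clip_pos_iff zero_less_divide_iff)
  show x: "\<delta> * x = a + p A - \<beta>\<^sub>B"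
    using lt gt \<delta>_pos assms by (simp add: Q_exp_policy clip_id)
  show y: "\<delta> * y = \<delta> - a - p A - \<beta>\<^sub>A"
    using lt gt a_pos \<delta>_pos assms(3,4,8,9) unfolding y_def
    by (simp add: Q_exp_policy clip_id right_diff_distrib)
  have "x = t * (x + y)"
    using t_pos by (simp add: assms(5) field_simps)
  then have "\<delta> * x = t * (\<delta> * x + \<delta> * y)"
    by (metis distrib_left mult.left_commute)
  then show "\<delta> * x = t * (\<delta> - \<beta>\<^sub>A - \<beta>\<^sub>B)"
    unfolding y x by (simp add: algebra_simps)
qed

text \<open>Without certificate prices in \<open>A\<close>, the cost advantage of \<open>B\<close> (\<open>a < \<delta> * t\<close>) makes
  \<open>A\<close> import more than its export credits allow.\<close>

lemma equilibrium_policy_no_barrier_A: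
  fixes \<beta>\<^sub>B p
  defines "x \<equiv> Q_exp w (policy 0 \<beta>\<^sub>B) p A" and "y \<equiv> Q_exp w (policy 0 \<beta>\<^sub>B) p B"
  assumes "0 \<le> \<beta>\<^sub>B" "equilibrium w (policy 0 \<beta>\<^sub>B) p"
  obtains (autarky) "x = 0" "y = 0" "0 \<le> p A" "0 \<le> p B" "T\<^sub>B = None \<Longrightarrow> p B = 0"
  | (binding) "y = \<eta> * x" "0 < x" "0 < y" "0 \<le> p A" "p B = 0"
proof -
  \<comment> \<open>A common refutation of the two cases in which A's certificates are worthless:
    there \<open>\<delta> * x \<le> a < \<delta> * t\<close>, while imports satisfy
    \<open>\<delta> * y \<ge> \<delta> - a > \<delta> * (1 - t)\<close>. Since
    \<open>\<eta> * t = 1 - t\<close>, this contradicts A's credit constraint.\<close>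
  have no_trade: False if "p A = 0" "0 < x" "y \<le> \<eta> * x" "0 \<le> p B" "p B = 0 \<or> y \<le> x"
  proof -
    have "0 < (a - p B - \<beta>\<^sub>B) / \<delta>"
      using that unfolding x_def by (simp add: Q_exp_policy clip_pos_iff)
    then have x: "\<delta> * x \<le> a"
      using \<delta>_pos a_le that assms(3) by (simp add: x_def Q_exp_policy clip_id)
    have "clip ((a - \<kappa> * p B) / \<delta>) \<le> a / \<delta>"
      using \<delta>_pos a_pos \<kappa>_nonneg that by (simp add: clip_def divide_right_mono min.coboundedI2)
    then have y: "\<delta> - a \<le> \<delta> * y"
      using that \<delta>_pos by (simp add: y_def Q_exp_policy field_simps)
    have "\<delta> * y \<le> \<eta> * (\<delta> * x)"
      using mult_left_mono[OF that(3), of \<delta>] \<delta>_pos by (simp add: mult.left_commute)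
    also have "\<dots> \<le> \<eta> * a"
      using x \<eta>_gt_1 by (intro mult_left_mono) auto
    also have "\<dots> < \<eta> * (\<delta> * t)"
      using a_less \<eta>_gt_1 by (intro mult_strict_left_mono) auto
    also have "\<dots> = \<delta> - \<delta> * t"
      unfolding mult.left_commute[of \<eta>] \<eta>_t by (simp add: right_diff_distrib)
    finally show False
      using y a_less by simp
  qed
  show ?thesis
    using assms(4)
  proof (cases rule: equilibrium_policyE)
    case binding_B
    have "x \<le> \<eta> * x"
      using binding_B(2) \<eta>_gt_1 by (simp add: x_def mult_le_cancel_right1 del: times_divide_eq_left)
    then show ?thesis
      using no_trade binding_B unfolding x_def y_def by force
  qed (use autarky binding no_trade in \<open>auto simp: x_def y_def\<close>)
qed

text \<open>Autarky without barriers needs \<open>a + p A \<le> p B\<close> to stop A's exports and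
  \<open>\<delta> \<le> a + p A - \<kappa> * p B\<close> to stop B's. Together they force
  \<open>p B > 0\<close> and \<open>\<kappa> < 1\<close>, which is exactly the situation in which
  coordination excludes autarky. Only the binding case remains, and it fixes volumes and
  prices.\<close>

lemma coordinated_outcome:
  assumes "coordinated_equilibrium w (policy 0 0) p"
  shows "p A = \<delta> * t - a" "p B = 0"
    "Q_exp w (policy 0 0) p A = t" "Q_exp w (policy 0 0) p B = 1 - t"
proof -
  let ?x = "Q_exp w (policy 0 0) p A" and ?y = "Q_exp w (policy 0 0) p B"
  have "equilibrium w (policy 0 0) p"
    using assms by (simp add: coordinated_equilibrium_def)
  with order.refl[of "0 :: real"] have *: "?y = \<eta> * ?x \<and> 0 < ?x \<and> 0 < ?y \<and> 0 \<le> p A \<and> p B = 0"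
  proof (cases rule: equilibrium_policy_no_barrier_A)
    case autarky
    have "\<not> 0 < (a + p A - p B) / \<delta>"
      using autarky(1) by (simp add: Q_exp_policy flip: clip_pos_iff)
    then have x: "a + p A \<le> p B"
      using \<delta>_pos by (simp add: zero_less_divide_iff not_less)
    have "\<not> (a + p A - \<kappa> * p B) / \<delta> < 1"
      using autarky(2) by (simp add: Q_exp_policy flip: clip_less_1_iff)
    then have y: "\<delta> \<le> a + p A - \<kappa> * p B"
      using \<delta>_pos by (simp add: not_less)
    have "p B \<noteq> 0"
      using x a_pos autarky by auto
    then obtain T where T: "T\<^sub>B = Some T"
      using autarky by (cases T\<^sub>B) auto
    have "\<kappa> < 1"
    proof (rule ccontr)
      assume "\<not> \<kappa> < 1"
      then have "1 * p B \<le> \<kappa> * p B"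
        using autarky by (intro mult_right_mono) auto
      then show False
        using x y \<delta>_pos by simp
    qed
    then have "share T * credit T < 1"
      unfolding \<kappa>_def by (simp add: T)
    moreover have "tic (policy 0 0 B) = Some T"
      unfolding policy_simps by (rule T)
    ultimately have "\<exists>i T. tic (policy 0 0 i) = Some T \<and> share T * credit T < 1"
      by blast
    then have "\<not> pure_autarky w (policy 0 0) p A"
      using assms unfolding coordinated_equilibrium_def by blast
    then show ?thesis
      using autarky by (simp add: pure_autarky_def Q_imp_def)
  qed simp
  then show "p B = 0"
    by simp
  have "\<delta> * ?x = t * \<delta>" and eq: "\<delta> * ?x = a + p A"
    using binding_outcome[of 0 0 p] * by auto
  then show x: "?x = t"
    using \<delta>_pos by simp
  then show "p A = \<delta> * t - a"
    using eq by simp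
  show "?y = 1 - t"
    using * x \<eta>_t by simp
qed

section \<open>Existence of equilibria at each barrier level\<close>

lemma coordinated_equilibrium_exists: "\<exists>p. coordinated_equilibrium w (policy 0 0) p"
proof -
  \<comment> \<open>This price of A moves both cutoffs to \<open>t\<close>. The resulting
    equilibrium has trade in both directions, so the coordination requirement holds.\<close>
  define p where "p i = (case i of A \<Rightarrow> \<delta> * t - a | B \<Rightarrow> 0)" for i
  have p: "p A = \<delta> * t - a" "p B = 0"
    by (simp_all add: p_def)
  have xy: "Q_exp w (policy 0 0) p A = t" "Q_exp w (policy 0 0) p B = 1 - t"
    using t_pos t_less \<delta>_pos by (simp_all add: Q_exp_policy p clip_id)
  have "equilibrium w (policy 0 0) p"
    using a_less t_pos by (intro equilibrium_policy_price_B_0) (simp_all add: p xy)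
  then have "coordinated_equilibrium w (policy 0 0) p"
    unfolding coordinated_equilibrium_def using xy t_pos t_less
    by (auto simp: pure_autarky_def all_country Q_imp_def)
  then show ?thesis by blast
qed

text \<open>Below \<delta> the barrier leaves room for a binding equilibrium with proportionally
  reduced trade. From \<delta> on, autarky is an equilibrium at a prohibitive price of A.\<close>

lemma equilibrium_exists_barrier_B:
  assumes "0 < \<beta>"
  shows "\<exists>p. equilibrium w (policy 0 \<beta>) p"
proof (cases "\<beta> < \<delta>")
  case True
  \<comment> \<open>The volume dictated by \<open>binding_outcome\<close>; the price below is then
    read off from A's export equation.\<close>
  define x where "x = t * (1 - \<beta> / \<delta>)"
  have x: "0 < x" "x < t"
    using True assms \<delta>_pos t_pos by (simp_all add: x_def)
  have "x / t = 1 - \<beta> / \<delta>"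
    using t_pos by (simp add: x_def)
  then have sum: "\<eta> * x = 1 - \<beta> / \<delta> - x"
    using t_pos by (simp add: diff_divide_distrib left_diff_distrib)
  then have sum': "\<delta> * (\<eta> * x) = \<delta> - \<beta> - \<delta> * x"
    using \<delta>_pos by (simp add: right_diff_distrib)
  define p where "p i = (case i of A \<Rightarrow> \<delta> * x + \<beta> - a | B \<Rightarrow> 0)" for i
  have p: "p A = \<delta> * x + \<beta> - a" "p B = 0"
    by (simp_all add: p_def)
  have "\<eta> * x < \<eta> * t"
    using x \<eta>_gt_1 by (intro mult_strict_left_mono) auto
  then have "\<eta> * x < 1 - t"
    using \<eta>_t by simp
  then have "\<delta> * (\<eta> * x) < \<delta> * (1 - t)"
    using \<delta>_pos by (intro mult_strict_left_mono) auto
  then have pA: "0 \<le> p A"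
    using a_less unfolding sum' p by (simp add: right_diff_distrib)
  have Qx: "Q_exp w (policy 0 \<beta>) p A = x"
    using x t_less \<delta>_pos by (simp add: Q_exp_policy p clip_id)
  have "(\<delta> * x + \<beta>) / \<delta> = 1 - \<eta> * x"
    using \<delta>_pos sum by (simp add: add_divide_distrib)
  then have Qy: "Q_exp w (policy 0 \<beta>) p B = \<eta> * x"
    using \<open>\<eta> * x < 1 - t\<close> t_pos x \<eta>_gt_1
    by (simp add: Q_exp_policy p clip_id del: times_divide_eq_left)
  have "equilibrium w (policy 0 \<beta>) p"
    using x pA by (intro equilibrium_policy_price_B_0) (simp_all add: p Qx Qy)
  then show ?thesis by blast
next
  case False
  \<comment> \<open>The least price that shuts out B's exports. It also subsidises A's exports, but
    the barrier is at least \<delta> and still stops them.\<close>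
  define p where "p i = (case i of A \<Rightarrow> \<delta> - a | B \<Rightarrow> 0)" for i
  have p: "p A = \<delta> - a" "p B = 0"
    by (simp_all add: p_def)
  have Q: "Q_exp w (policy 0 \<beta>) p A = 0" "Q_exp w (policy 0 \<beta>) p B = 0"
    using False \<delta>_pos by (simp_all add: Q_exp_policy p clip_nonpos clip_ge_1 divide_nonpos_pos)
  then have "equilibrium w (policy 0 \<beta>) p"
    unfolding equilibrium_policy_iff Q p
    using a_le a_pos \<delta>_pos by (simp split: option.split)
  then show ?thesis by blast
qed

text \<open>The cases follow what happens at zero prices. If A's credit constraint fails there, a
  positive price of A makes it bind. If both constraints hold, zero prices are an equilibrium. If
  only B's constraint fails, B's price is raised until its market clears or all trade has
  ceased.\<close>

lemma equilibrium_exists_barrier_A: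
  assumes "0 < \<beta>"
  shows "\<exists>p. equilibrium w (policy \<beta> 0) p"
proof (cases "\<eta> * a < \<delta> - a - \<beta>")
  case True
  then have "t * (\<eta> * a) < t * (\<delta> - a - \<beta>)"
    using t_pos by (intro mult_strict_left_mono)
  then have a': "a < t * (\<delta> - \<beta>)"
    unfolding mult.assoc[symmetric] mult.commute[of t \<eta>] \<eta>_t by (simp add: algebra_simps)
  have "\<beta> < \<delta>"
    using a' t_pos a_pos by (smt (verit) mult_nonneg_nonpos)
  define x where "x = t * (1 - \<beta> / \<delta>)"
  have x: "0 < x" "x < t"
    using \<open>\<beta> < \<delta>\<close> assms \<delta>_pos t_pos by (simp_all add: x_def)
  have "x / t = 1 - \<beta> / \<delta>"
    using t_pos by (simp add: x_def)
  then have sum: "\<eta> * x = 1 - \<beta> / \<delta> - x"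
    using t_pos by (simp add: diff_divide_distrib left_diff_distrib)
  define p where "p i = (case i of A \<Rightarrow> \<delta> * x - a | B \<Rightarrow> 0)" for i
  have p: "p A = \<delta> * x - a" "p B = 0"
    by (simp_all add: p_def)
  have "\<delta> * x = t * (\<delta> - \<beta>)"
    using \<delta>_pos by (simp add: x_def field_simps)
  then have pA: "0 \<le> p A"
    using a' by (simp add: p)
  have Qx: "Q_exp w (policy \<beta> 0) p A = x"
    using x t_less \<delta>_pos by (simp add: Q_exp_policy p clip_id)
  have "(\<delta> * x + \<beta>) / \<delta> = 1 - \<eta> * x"
    using \<delta>_pos sum by (simp add: add_divide_distrib)
  moreover have "0 \<le> \<eta> * x"
    using x \<eta>_gt_1 by (intro mult_nonneg_nonneg) auto
  moreover have "\<eta> * x \<le> 1"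
    unfolding sum using x assms \<delta>_pos divide_pos_pos[of \<beta> \<delta>] by linarith
  ultimately have Qy: "Q_exp w (policy \<beta> 0) p B = \<eta> * x"
    by (simp add: Q_exp_policy p clip_id del: times_divide_eq_left)
  have "equilibrium w (policy \<beta> 0) p"
    using x pA by (intro equilibrium_policy_price_B_0) (simp_all add: p Qx Qy)
  then show ?thesis by blast
next
  case False
  define y where "y = 1 - clip ((a + \<beta>) / \<delta>)"
  have y: "\<delta> * y = max 0 (\<delta> - a - \<beta>)"
    using \<delta>_pos a_pos assms by (auto simp: y_def clip_def max_def min_def field_simps)
  show ?thesis
  proof (cases "T\<^sub>B = None \<or> (\<exists>T. T\<^sub>B = Some T \<and> a / \<delta> \<le> credit T * y)")
    case True
    have Q: "Q_exp w (policy \<beta> 0) (\<lambda>_. 0) A = a / \<delta>" "Q_exp w (policy \<beta> 0) (\<lambda>_. 0) B = y"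
      using a_pos a_le \<delta>_pos by (simp_all add: Q_exp_policy y_def clip_id)
    have "0 \<le> \<eta> * a"
      using \<eta>_gt_1 a_pos by (intro mult_nonneg_nonneg) auto
    then have "\<delta> * y \<le> \<eta> * a"
      using False by (simp add: y)
    then have "y \<le> \<eta> * (a / \<delta>)"
      using \<delta>_pos t_pos by (simp add: field_simps)
    moreover have "0 < a / \<delta>" "0 \<le> y"
      using a_pos \<delta>_pos clip_bounds by (auto simp: y_def)
    moreover have "y \<noteq> 0" if "a / \<delta> \<le> credit T * y" for T :: tic_scheme
      using that \<open>0 < a / \<delta>\<close> by auto
    ultimately have "equilibrium w (policy \<beta> 0) (\<lambda>_. 0)"
      using True unfolding equilibrium_policy_iff Q by (auto split: option.split)
    then show ?thesis by blast
  next
    case False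
    then obtain T where T: "T\<^sub>B = Some T" and less: "credit T * y < a / \<delta>"
      by (cases T\<^sub>B) auto
    define e where "e = credit T"
    have e: "1 \<le> e"
      using T\<^sub>B T by (simp add: e_def)
    show ?thesis
    \<comment> \<open>At B's price \<open>a\<close> the exports of A cease. The case condition says
      that the rebate \<open>\<kappa> * a\<close> is then still too small to make B export.\<close>
    proof (cases "\<kappa> * a \<le> \<beta> - (\<delta> - a)")
      case True
      define p where "p i = (case i of A \<Rightarrow> 0 | B \<Rightarrow> a)" for i
      have p: "p A = 0" "p B = a"
        by (simp_all add: p_def)
      have Q: "Q_exp w (policy \<beta> 0) p A = 0" "Q_exp w (policy \<beta> 0) p B = 0"
        using True \<delta>_pos by (simp_all add: Q_exp_policy p clip_nonpos clip_ge_1)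
      then have "equilibrium w (policy \<beta> 0) p"
        unfolding equilibrium_policy_iff Q p using a_pos T by simp
      then show ?thesis by blast
    next
      case False
      \<comment> \<open>The solution of
        \<open>a - \<pi> = e * (\<delta> - a - \<beta> + \<kappa> * \<pi>)\<close>, which is B's
        binding condition \<open>x = e * y\<close> multiplied by \<delta>.\<close>
      define \<pi> where "\<pi> = (a - e * (\<delta> - a - \<beta>)) / (1 + e * \<kappa>)"
      define p where "p i = (case i of A \<Rightarrow> 0 | B \<Rightarrow> \<pi>)" for i
      have p: "p A = 0" "p B = \<pi>"
        by (simp_all add: p_def)
      have pos: "0 < 1 + e * \<kappa>"
        using e \<kappa>_nonneg by (simp add: add_pos_nonneg)
      have "e * (\<delta> - a - \<beta>) \<le> e * (\<delta> * y)"
        using e by (intro mult_left_mono) (auto simp: y)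
      also have "\<dots> < a"
        using less \<delta>_pos by (simp add: e_def pos_less_divide_eq algebra_simps)
      finally have "0 < \<pi>"
        using pos by (simp add: \<pi>_def)
      have "0 < e * (\<kappa> * a - (\<beta> - (\<delta> - a)))"
        using False e by (intro mult_pos_pos) auto
      then have "\<pi> < a"
        using pos by (simp add: \<pi>_def pos_divide_less_eq algebra_simps)
      have \<pi>: "\<pi> * (1 + e * \<kappa>) = a - e * (\<delta> - a - \<beta>)"
        using pos by (simp add: \<pi>_def)
      define x where "x = (a - \<pi>) / \<delta>"
      have x: "0 < x" "x \<le> 1"
        using \<open>\<pi> < a\<close> \<open>0 < \<pi>\<close> a_le \<delta>_pos by (simp_all add: x_def)
      have x_e: "0 < x / e" "x / e \<le> x"
        using x e by (simp_all add: divide_le_eq mult_le_cancel_left1)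
      have "a - \<kappa> * \<pi> + \<beta> = \<delta> - (a - \<pi>) / e"
        using e \<pi> by (simp add: field_simps)
      then have "(a - \<kappa> * \<pi> + \<beta>) / \<delta> = 1 - x / e"
        using \<delta>_pos by (simp add: x_def diff_divide_distrib mult.commute)
      then have Q: "Q_exp w (policy \<beta> 0) p A = x" "Q_exp w (policy \<beta> 0) p B = x / e"
        using x x_e by (simp_all add: Q_exp_policy p clip_id flip: x_def)
      have "x / e \<le> \<eta> * x"
        using x_e x \<eta>_gt_1 mult_right_mono[of 1 \<eta> x] by simp
      then have "equilibrium w (policy \<beta> 0) p"
        using x e \<open>0 < \<pi>\<close> T unfolding equilibrium_policy_iff p Q by (simp add: e_def)
      then show ?thesis by blast
    qed
  qed
qed

section \<open>Comparison of utilities with and without a barrier\<close>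

text \<open>Without barriers A produces exactly \<open>2 * t\<close> and pays no penalty, so
  dropping the penalty at the barrier only strengthens the claim. What is left is the gain from
  trade \<open>S\<close>. In a binding equilibrium it is \<open>\<delta> * y^2 / 2\<close> plus the
  certificate revenue \<open>p' A * (y - x)\<close> not passed on to exporters, and the barrier
  lowers both; in the other equilibria no such revenue arises.\<close>

lemma zero_barrier_strictly_better_A:
  assumes "0 < \<beta>" "0 \<le> lam"
    and base: "coordinated_equilibrium w (policy 0 0) p"
    and eq: "equilibrium w (policy \<beta> 0) p'"
  shows "utility lam (2 * t) gam w (policy \<beta> 0) p' A < utility lam (2 * t) gam w (policy 0 0) p A"
proof -
  define x where "x = Q_exp w (policy \<beta> 0) p' A"
  define y where "y = Q_exp w (policy \<beta> 0) p' B"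
  define S where "S = \<delta> * (y - y\<^sup>2 / 2) - (a - \<kappa> * p' B + \<beta>) * y - p' A * x"
  have "0 \<le> y"
    using clip_bounds by (simp add: y_def Q_exp_policy)
  have gain: "0 < (\<delta> * t - a) * (1 - 2 * t)"
    using a_less t_less by simp
  \<comment> \<open>Settles every case except the binding one: the baseline contains the positive
    revenue \<open>gain\<close> on top of the import surplus.\<close>
  have small: "S < \<delta> * (1 - t)\<^sup>2 / 2 + (\<delta> * t - a) * (1 - 2 * t)"
    if "y < 1 - t" "S \<le> \<delta> * y\<^sup>2 / 2"
  proof -
    have "y\<^sup>2 \<le> (1 - t)\<^sup>2"
      using that \<open>0 \<le> y\<close> by (intro power_mono) auto
    then have "\<delta> * y\<^sup>2 / 2 \<le> \<delta> * (1 - t)\<^sup>2 / 2"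
      using \<delta>_pos by simp
    then show ?thesis
      using that gain by simp
  qed
  have interior: "\<delta> * y = \<delta> - (a + p' A - \<kappa> * p' B + \<beta>)" if "0 < y" "y < 1"
    using that \<delta>_pos unfolding y_def Q_exp_policy
    by (auto simp: clip_def min_def max_def field_simps split: if_splits)
  \<comment> \<open>At an interior cutoff and with \<open>p' A = 0\<close>, A gains nothing on the
    marginal import, so the saving rises from 0 with slope \<delta> over an interval of length
    \<open>y\<close>.\<close>
  have S_no_price: "S \<le> \<delta> * y\<^sup>2 / 2" if "p' A = 0" "y < 1"
  proof (cases "y = 0")
    case False
    then have "a - \<kappa> * p' B + \<beta> = \<delta> - \<delta> * y"
      using interior that \<open>0 \<le> y\<close> by simp
    then have "S = \<delta> * (y - y\<^sup>2 / 2) - (\<delta> - \<delta> * y) * y"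
      by (simp add: S_def that)
    then show ?thesis
      by (simp add: power2_eq_square field_simps)
  qed (simp add: S_def that)
  have "S < \<delta> * (1 - t)\<^sup>2 / 2 + (\<delta> * t - a) * (1 - 2 * t)"
    using eq
  proof (cases rule: equilibrium_policyE)
    case autarky
    then show ?thesis
      using small t_less by (simp add: S_def x_def y_def)
  next
    case binding
    have x: "\<delta> * x = a + p' A" "\<delta> * y = \<delta> - a - p' A - \<beta>" "\<delta> * x = t * (\<delta> - \<beta>)"
      using binding_outcome[of \<beta> 0 p'] binding assms(1) by (auto simp: x_def y_def)
    have "x < t"
    proof -
      have "t * (\<delta> - \<beta>) < \<delta> * t"
        using t_pos assms(1) by (simp add: algebra_simps)
      then show ?thesis
        using x(3) \<delta>_pos by (metis mult_less_cancel_left_pos)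
    qed
    have y_x: "y = \<eta> * x"
      using binding by (simp add: x_def y_def)
    have "y < \<eta> * t"
      unfolding y_x using \<open>x < t\<close> \<eta>_gt_1 by (intro mult_strict_left_mono) auto
    then have "y < 1 - t"
      using \<eta>_t by simp
    have "(\<eta> - 1) * x < (\<eta> - 1) * t"
      using \<open>x < t\<close> \<eta>_gt_1 by (intro mult_strict_left_mono) auto
    then have "y - x < 1 - 2 * t"
      unfolding y_x left_diff_distrib \<eta>_t by simp
    have "p' A < \<delta> * t - a"
      using x(1) \<open>x < t\<close> \<delta>_pos mult_strict_left_mono[of x t \<delta>] by simp
    \<comment> \<open>Price and import surplus are both below their baseline values; a weak bound
      suffices because the term in \<open>y\<close> is strictly smaller.\<close>
    have "p' A * (y - x) \<le> (\<delta> * t - a) * (1 - 2 * t)"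
      using \<open>p' A < \<delta> * t - a\<close> \<open>y - x < 1 - 2 * t\<close> binding(4) a_less t_less
      by (intro order.trans[OF mult_left_mono mult_right_mono]) auto
    moreover have "\<delta> * y\<^sup>2 / 2 < \<delta> * (1 - t)\<^sup>2 / 2"
      using \<open>y < 1 - t\<close> \<open>0 \<le> y\<close> \<delta>_pos by (simp add: power_strict_mono)
    moreover have "S = \<delta> * y\<^sup>2 / 2 + p' A * (y - x)"
    proof -
      have "a + \<beta> = \<delta> - \<delta> * y - p' A"
        using x(2) by simp
      then have "S = \<delta> * (y - y\<^sup>2 / 2) - (\<delta> - \<delta> * y - p' A) * y - p' A * x"
        by (simp add: S_def binding(5))
      then show ?thesis
        by (simp add: power2_eq_square field_simps)
    qed
    ultimately show ?thesis
      by simp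
  next
    case non_binding
    have "x = a / \<delta>"
      using non_binding a_pos a_le \<delta>_pos by (simp add: x_def Q_exp_policy clip_id)
    then have "x < t"
      using a_less \<delta>_pos by (simp add: pos_divide_less_eq mult.commute)
    then have "\<eta> * x < \<eta> * t"
      using \<eta>_gt_1 by (intro mult_strict_left_mono) auto
    then have "y < 1 - t"
      using non_binding \<eta>_t by (simp add: x_def y_def)
    then show ?thesis
      using small S_no_price non_binding t_pos by simp
  next
    case binding_B
    have "0 < (a - p' B) / \<delta>"
      using binding_B unfolding Q_exp_policy clip_pos_iff by simp
    then have "\<delta> * x < a"
      using \<delta>_pos a_le binding_B by (simp add: x_def Q_exp_policy clip_id)
    then have "\<delta> * x < \<delta> * t"
      using a_less by simp
    then have "y < 1 - t"
      using \<delta>_pos t_less binding_B by (simp add: x_def y_def)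
    then show ?thesis
      using small S_no_price binding_B t_pos by simp
  qed
  moreover have "utility lam (2 * t) gam w (policy \<beta> 0) p' A \<le> S - integral {0..1} (w A)"
    using assms(2) by (simp add: utility_A S_def x_def y_def)
  moreover have "utility lam (2 * t) gam w (policy 0 0) p A
      = \<delta> * (1 - t)\<^sup>2 / 2 + (\<delta> * t - a) * (1 - 2 * t) - integral {0..1} (w A)"
    unfolding utility_A coordinated_outcome[OF base]
    by (simp add: field_simps power2_eq_square)
  ultimately show ?thesis
    by simp
qed

text \<open>As A sets no barrier, only autarky and the binding case occur. In the latter B's utility
  is, up to a constant, \<open>gam * (1 + (\<eta> - 1) * x) + \<delta> * x^2 / 2\<close>, which
  increases in \<open>x\<close>, and the barrier pushes \<open>x\<close> below \<open>t\<close>.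
  Autarky loses because B's production drops from \<open>2 - 2 * t\<close> to 1 and its gains from
  trade vanish.\<close>

lemma zero_barrier_strictly_better_B:
  assumes "0 < \<beta>" "0 < gam"
    and base: "coordinated_equilibrium w (policy 0 0) p"
    and eq: "equilibrium w (policy 0 \<beta>) p'"
  shows "utility lam X gam w (policy 0 \<beta>) p' B < utility lam X gam w (policy 0 0) p B"
proof -
  define x where "x = Q_exp w (policy 0 \<beta>) p' A"
  define y where "y = Q_exp w (policy 0 \<beta>) p' B"
  have base_u: "utility lam X gam w (policy 0 0) p B
      = gam * (2 - 2 * t) + \<delta> * t\<^sup>2 / 2 - integral {0..1} (w B)"
    unfolding utility_B coordinated_outcome[OF base]
    by (simp add: field_simps power2_eq_square)
  show ?thesis
    using less_imp_le[OF assms(1)] eq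
  proof (cases rule: equilibrium_policy_no_barrier_A)
    case autarky
    have "gam * 1 < gam * (2 - 2 * t)"
      using t_less assms(2) by (intro mult_strict_left_mono) auto
    moreover have "0 < \<delta> * t\<^sup>2 / 2"
      using \<delta>_pos t_pos by simp
    ultimately show ?thesis
      unfolding base_u unfolding utility_B autarky(1,2) by simp
  next
    case binding
    have x: "\<delta> * x = a + p' A - \<beta>" "\<delta> * x = t * (\<delta> - \<beta>)"
      using binding_outcome[of 0 \<beta> p'] binding assms(1) by (auto simp: x_def)
    have "x < t"
    proof -
      have "t * (\<delta> - \<beta>) < \<delta> * t"
        using t_pos assms(1) by (simp add: algebra_simps)
      then show ?thesis
        using x(2) \<delta>_pos by (metis mult_less_cancel_left_pos)
    qed
    have "(\<eta> - 1) * x < (\<eta> - 1) * t"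
      using \<open>x < t\<close> \<eta>_gt_1 by (intro mult_strict_left_mono) auto
    then have "1 - x + \<eta> * x < 2 - 2 * t"
      unfolding left_diff_distrib \<eta>_t by simp
    then have "gam * (1 - x + \<eta> * x) < gam * (2 - 2 * t)"
      using assms(2) by (intro mult_strict_left_mono)
    moreover have "\<delta> * x\<^sup>2 / 2 < \<delta> * t\<^sup>2 / 2"
      using \<open>x < t\<close> binding(2) \<delta>_pos by (simp add: x_def power_strict_mono)
    moreover have "utility lam X gam w (policy 0 \<beta>) p' B
        = gam * (1 - x + \<eta> * x) + \<delta> * x\<^sup>2 / 2 - integral {0..1} (w B)"
      unfolding utility_B binding(1,5) x_def[symmetric] x(1)[symmetric]
      by (simp add: power2_eq_square)
    ultimately show ?thesis
      by (simp add: base_u)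
  qed
qed

lemma zero_barrier_strictly_optimal:
  assumes "0 \<le> lam" "0 < gam"
  shows "zero_barrier_strictly_optimal lam (2 * t) gam w (tic_agreement T\<^sub>A T\<^sub>B) i"
  using assms coordinated_equilibrium_exists equilibrium_exists_barrier_A
    equilibrium_exists_barrier_B zero_barrier_strictly_better_A zero_barrier_strictly_better_B
  by (cases i) (auto simp: zero_barrier_strictly_optimal_def with_barrier_tic_agreement)

end

section \<open>B's barrier under the No-TIC Agreement\<close>

text \<open>The witness is the smallest prohibitive barrier \<open>\<beta>\<^sub>B = \<delta> t\<close>, \<open>t = Xbar / 2\<close>.\<close>

lemma (in linear_cost_gap) no_tic_barrier_incentive_B:
  assumes "a = \<alpha> A" "\<delta> = \<alpha> A + \<alpha> B" "0 < \<alpha> A" "0 < t" "t < 1" "gam > \<delta> * t"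
  shows "barrier_incentive_no_tic lam (2 * t) gam w (no_tic_agreement \<alpha> (2 * t)) B"
proof -
  define P where "P b = with_barrier (no_tic_agreement \<alpha> (2 * t)) B b" for b
  \<comment> \<open>The fixed tariff and export subsidy equal the certificate price of A under the
    TIC Agreement at zero barriers, so both agreements start from the same trade volumes.\<close>
  have e: "\<alpha> A * chi_A \<alpha> (2 * t) = \<delta> * t - a"
    using assms(1,3) \<delta>_pos
    unfolding chi_A_def free_trade_production_A_def assms(2)[symmetric]
    unfolding assms(1)[symmetric]
    by (simp add: field_simps)
  have P [simp]: "prod_subsidy (P b A) = 0" "prod_subsidy (P b B) = 0"
    "barrier (P b A) = 0" "barrier (P b B) = b"
    "eff_exp_subsidy (P b) (\<lambda>_. 0) A = \<delta> * t - a" "eff_exp_subsidy (P b) (\<lambda>_. 0) B = 0"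
    "eff_tariff (P b) (\<lambda>_. 0) A = \<delta> * t - a" "eff_tariff (P b) (\<lambda>_. 0) B = 0" for b
    by (simp_all add: P_def with_barrier_def no_tic_agreement_def Let_def eff_exp_subsidy_def
        eff_tariff_def e)
  \<comment> \<open>In contrast to the TIC Agreement, B's exports do not react to its own
    barrier.\<close>
  have y: "Q_exp w (P b) (\<lambda>_. 0) B = 1 - t" for b
    using assms(4,5) \<delta>_pos by (simp add: Q_exp_B cutoff_B_def clip_id)
  have x0: "Q_exp w (P 0) (\<lambda>_. 0) A = t" and x1: "Q_exp w (P (\<delta> * t)) (\<lambda>_. 0) A = 0"
    using assms(4,5) \<delta>_pos by (simp_all add: Q_exp_A cutoff_A_def clip_id)
  have u0: "utility lam (2 * t) gam w (P 0) (\<lambda>_. 0) B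
      = gam * (2 - 2 * t) + \<delta> * t * t / 2 - integral {0..1} (w B)"
    by (simp add: utility_def production_eq direct_cost_B y x0 power2_eq_square field_simps)
  have u1: "utility lam (2 * t) gam w (P (\<delta> * t)) (\<lambda>_. 0) B
      = gam * (2 - t) - integral {0..1} (w B)"
    by (simp add: utility_def production_eq direct_cost_B y x1)
  \<comment> \<open>Ending imports raises B's production by \<open>t\<close>, worth
    \<open>gam * t\<close>, and costs it the import surplus
    \<open>\<delta> * t * t / 2\<close>.\<close>
  have "\<delta> * t * t < gam * t"
    using assms by simp
  moreover have "0 < \<delta> * t * t"
    using assms \<delta>_pos by simp
  ultimately have "utility lam (2 * t) gam w (P 0) (\<lambda>_. 0) B
      < utility lam (2 * t) gam w (P (\<delta> * t)) (\<lambda>_. 0) B"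
    unfolding u0 u1 by (simp add: algebra_simps)
  then show ?thesis
    unfolding barrier_incentive_no_tic_def P_def using assms \<delta>_pos
    by (intro exI[of _ "\<delta> * t"]) simp
qed

theorem proposition8:
  fixes w :: "country \<Rightarrow> real \<Rightarrow> real"
    and \<alpha> :: "country \<Rightarrow> real"
    and Xbar \<gamma>\<^sub>B \<delta> :: real
    and T\<^sub>A :: tic_scheme
    and T\<^sub>B :: "tic_scheme option"
  assumes "\<And>i. 0 < \<alpha> i"
    and "\<delta> = \<alpha> A + \<alpha> B"
    and "\<And>m. m \<in> {0..1} \<Longrightarrow> w A m - w B m = - \<alpha> A + \<delta> * m"
    and "\<And>i. w i integrable_on {0..1}"
    and "\<alpha> A \<le> \<alpha> B"
    and "free_trade_production_A \<alpha> < Xbar"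
    and "Xbar < 1"
    and "0 < \<gamma>\<^sub>B"
    and "credit T\<^sub>A = eta_A Xbar"
    and "share T\<^sub>A * credit T\<^sub>A = 1"
    and "\<And>T. T\<^sub>B = Some T \<Longrightarrow> 1 \<le> credit T \<and> 0 \<le> share T \<and> share T \<le> 1"
  shows "\<forall>\<^sub>F lam in at_top.
     (\<forall>i. zero_barrier_strictly_optimal lam Xbar \<gamma>\<^sub>B w (tic_agreement T\<^sub>A T\<^sub>B) i) \<and>
     (\<gamma>\<^sub>B > \<delta> / (1 + eta_A Xbar) \<longrightarrow>
        barrier_incentive_no_tic lam Xbar \<gamma>\<^sub>B w (no_tic_agreement \<alpha> Xbar) B)"
proof -
  define t where "t = Xbar / 2"
  have X: "Xbar = 2 * t"
    by (simp add: t_def)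
  have \<delta>_pos: "0 < \<delta>"
    using assms(1)[of A] assms(1)[of B] assms(2) by simp
  have a_less: "\<alpha> A < \<delta> * t"
    using assms(6) \<delta>_pos unfolding free_trade_production_A_def X assms(2)[symmetric]
    by (simp add: field_simps)
  have eta: "eta_A Xbar = (1 - t) / t"
    by (simp add: eta_A_def X divide_simps)
  interpret tic_economy w "\<alpha> A" \<delta> T\<^sub>A T\<^sub>B t
    using assms \<delta>_pos a_less X eta by unfold_locales auto
  \<comment> \<open>Because \<open>1 + eta_A Xbar = 1 / t\<close>.\<close>
  have threshold: "\<delta> / (1 + eta_A Xbar) = \<delta> * t"
    using t_pos by (simp add: eta field_simps)
  show ?thesis
    \<comment> \<open>The bound 0 for \<open>lam\<close> makes the penalty term nonpositive, as the
      comparison for A requires.\<close>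
    using eventually_ge_at_top[of 0]
  proof eventually_elim
    case (elim lam)
    then show ?case
      using zero_barrier_strictly_optimal no_tic_barrier_incentive_B[of \<alpha> t \<gamma>\<^sub>B lam]
        assms(1,2,8) t_pos t_less
      unfolding threshold unfolding X by simp
  qed
qed

end
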